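(* Let $(G,H,\mathcal G)$ be a generalized pseudo-Riemannian Lie group with Lie algebra $\mathfrak g$. Then the Riemannian divergence of $\mathcal G$ satisfies $$\delta^{\mathcal G}(v)=-\tau(\pi(v)),\qquad v\in E=\mathfrak g\oplus\mathfrak g^*,$$ where $\tau\in\mathfrak g^*$ is the trace-form $\tau(X)=\mathrm{tr}\,\mathrm{ad}_X$ and $\pi:E\to\mathfrak g$ is the canonical projection. In particular, the Riemannian divergence is zero if $G$ is unimodular.
   Context: $E=\mathfrak g\oplus\mathfrak g^*$ is the space of left-invariant sections of $\mathbb TG=TG\oplus T^*G$, with scalar product $\langle X+\xi,Y+\eta\rangle=\frac12(\xi(Y)+\eta(X))$. A generalized pseudo-Riemannian Lie group $(G,H,\mathcal G)$ consists of a Lie group $G$, a closed left-invariant three-form $H$ and $\mathcal G\in\mathrm{Sym}^2E^*$ such that the endomorphism $\mathcal G^{\mathrm{end}}$ defined by $\langle\mathcal G^{\mathrm{end}}\cdot,\cdot\rangle=\mathcal G$ is an involution and $\mathcal G|_{\mathfrak g^*}$ is non-degenerate. The left-invariant pseudo-Riemannian metric $g$ on $G$ associated with $\mathcal G$ is determined by $\mathcal G(\xi,\eta)=\frac12g^{-1}(\xi,\eta)$ for $\xi,\eta\in\mathfrak g^*$. The Riemannian divergence is $\delta^{\mathcal G}(v)=\mathrm{tr}(\nabla\pi(v))=\mathrm{tr}(Y\mapsto\nabla_Y\pi(v))$, where $\nabla$ is the Levi-Civita connection of $g$. $G$ is unimodular if $\tau=0$. *)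

theory Defs
  imports "HOL-Analysis.Analysis" "HOL-Library.Function_Algebras"
begin

text \<open>Functions into a real vector space form a real vector space under the pointwise operations;
  the additive and multiplicative structure is that of HOL-Library.Function-Algebras.\<close>

instantiation "fun" :: (type, real_vector) real_vector
begin

definition scaleR_fun :: "real \<Rightarrow> ('a \<Rightarrow> 'b) \<Rightarrow> 'a \<Rightarrow> 'b" where
  "scaleR_fun c f = (\<lambda>x. c *\<^sub>R f x)"

instance
  by standard (auto simp: scaleR_fun_def fun_eq_iff scaleR_add_right scaleR_add_left)

end


section \<open>Linear algebra on subspaces\<close>

definition linear_on :: "'v::real_vector set \<Rightarrow> ('v \<Rightarrow> 'w::real_vector) \<Rightarrow> bool" where
  "linear_on V f \<longleftrightarrow>
     (\<forall>x\<in>V. \<forall>y\<in>V. f (x + y) = f x + f y) \<and> (\<forall>c. \<forall>x\<in>V. f (c *\<^sub>R x) = c *\<^sub>R f x)"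

definition bilinear_form_on :: "'v::real_vector set \<Rightarrow> ('v \<Rightarrow> 'v \<Rightarrow> real) \<Rightarrow> bool" where
  "bilinear_form_on V b \<longleftrightarrow>
     (\<forall>x\<in>V. linear_on V (\<lambda>y. b x y)) \<and> (\<forall>y\<in>V. linear_on V (\<lambda>x. b x y))"

definition symmetric_on :: "'v set \<Rightarrow> ('v \<Rightarrow> 'v \<Rightarrow> real) \<Rightarrow> bool" where
  "symmetric_on V b \<longleftrightarrow> (\<forall>x\<in>V. \<forall>y\<in>V. b x y = b y x)"

definition nondegenerate_on :: "'v::zero set \<Rightarrow> ('v \<Rightarrow> 'v \<Rightarrow> real) \<Rightarrow> bool" where
  "nondegenerate_on V b \<longleftrightarrow> (\<forall>x\<in>V. (\<forall>y\<in>V. b x y = 0) \<longrightarrow> x = 0)"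

text \<open>Functionals on a subspace are normalised to vanish off the subspace, so that equality of
  functionals is equality of functions.\<close>

definition dual_on :: "'v::real_vector set \<Rightarrow> ('v \<Rightarrow> real) set" where
  "dual_on V = {\<xi>. linear_on V \<xi> \<and> (\<forall>x. x \<notin> V \<longrightarrow> \<xi> x = 0)}"

definition flat_on :: "'v::real_vector set \<Rightarrow> ('v \<Rightarrow> 'v \<Rightarrow> real) \<Rightarrow> 'v \<Rightarrow> 'v \<Rightarrow> real" where
  "flat_on V b x = (\<lambda>y. if y \<in> V then b x y else 0)"

text \<open>\<open>h\<close> is the form \<open>b\<^sup>-\<^sup>1\<close> on the dual space: as maps \<open>V \<rightarrow> V*\<close> and \<open>V* \<rightarrow> V** = V\<close>,
  the forms \<open>b\<close> and \<open>h\<close> are inverse to each other.\<close>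

definition inverse_form_on ::
    "'v::real_vector set \<Rightarrow> ('v \<Rightarrow> 'v \<Rightarrow> real) \<Rightarrow> (('v \<Rightarrow> real) \<Rightarrow> ('v \<Rightarrow> real) \<Rightarrow> real) \<Rightarrow> bool" where
  "inverse_form_on V b h \<longleftrightarrow>
     bilinear_form_on (dual_on V) h \<and>
     (\<forall>x\<in>V. \<forall>\<eta>\<in>dual_on V. h (flat_on V b x) \<eta> = \<eta> x)"

text \<open>Trace of an endomorphism \<open>T\<close> of a finite-dimensional subspace \<open>V\<close>. It does not depend on
  the basis; if \<open>V\<close> has no finite basis, it is \<open>0\<close> by convention. Below it is only used for
  the Lie algebra of a Lie group, which is finite-dimensional.\<close>

definition trace_on :: "'v::real_vector set \<Rightarrow> ('v \<Rightarrow> 'v) \<Rightarrow> real" where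
  "trace_on V T =
     (if \<exists>B. finite B \<and> independent B \<and> span B = V
      then let B = (SOME B. finite B \<and> independent B \<and> span B = V)
           in \<Sum>b\<in>B. representation B (T b) b
      else 0)"


section \<open>Smooth manifolds\<close>

text \<open>On an open set \<open>S\<close> of a finite-dimensional space, \<open>C_on k S f\<close> says that \<open>f\<close> is of
  class \<open>C\<^sup>k\<close> on \<open>S\<close>.\<close>

fun C_on :: "nat \<Rightarrow> 'a::real_normed_vector set \<Rightarrow> ('a \<Rightarrow> 'b::real_normed_vector) \<Rightarrow> bool" where
  "C_on 0 S f \<longleftrightarrow> continuous_on S f"
| "C_on (Suc k) S f \<longleftrightarrow>
     (\<forall>x\<in>S. f differentiable (at x)) \<and> (\<forall>v. C_on k S (\<lambda>x. frechet_derivative f (at x) v))"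

definition smooth_on :: "'a::real_normed_vector set \<Rightarrow> ('a \<Rightarrow> 'b::real_normed_vector) \<Rightarrow> bool" where
  "smooth_on S f \<longleftrightarrow> (\<forall>k. C_on k S f)"

type_synonym ('a, 'e) atlas = "('a set \<times> ('a \<Rightarrow> 'e)) set"

text \<open>The model space is a finite-dimensional Euclidean space. The class \<open>euclidean_space\<close> is
  avoided because it excludes dimension \<open>0\<close>, that is, discrete Lie groups. Hausdorff and second
  countable are imposed by the type classes. The atlas need not be maximal.\<close>

definition smooth_atlas ::
    "('a::{t2_space,second_countable_topology}, 'e::real_inner) atlas \<Rightarrow> bool" where
  "smooth_atlas A \<longleftrightarrow>
     (\<exists>B::'e set. finite B \<and> (\<forall>u\<in>B. \<forall>v\<in>B. u \<bullet> v = (if u = v then 1 else 0)) \<and> span B = UNIV) \<and>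
     (\<forall>(U, \<phi>)\<in>A. open U \<and> open (\<phi> ` U) \<and> homeomorphism U (\<phi> ` U) \<phi> (inv_into U \<phi>)) \<and>
     (\<Union>(U, \<phi>)\<in>A. U) = UNIV \<and>
     (\<forall>(U, \<phi>)\<in>A. \<forall>(V, \<psi>)\<in>A. smooth_on (\<phi> ` (U \<inter> V)) (\<psi> \<circ> inv_into U \<phi>))"

definition prod_atlas :: "('a, 'e) atlas \<Rightarrow> ('b, 'f) atlas \<Rightarrow> ('a \<times> 'b, 'e \<times> 'f) atlas" where
  "prod_atlas A B = {(U \<times> V, map_prod \<phi> \<psi>) |U \<phi> V \<psi>. (U, \<phi>) \<in> A \<and> (V, \<psi>) \<in> B}"

definition smooth_map ::
    "('a::topological_space, 'e::real_normed_vector) atlas \<Rightarrow>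
     ('b::topological_space, 'f::real_normed_vector) atlas \<Rightarrow> ('a \<Rightarrow> 'b) \<Rightarrow> bool" where
  "smooth_map A B F \<longleftrightarrow>
     continuous_on UNIV F \<and>
     (\<forall>(U, \<phi>)\<in>A. \<forall>(V, \<psi>)\<in>B. smooth_on (\<phi> ` (U \<inter> F -` V)) (\<psi> \<circ> F \<circ> inv_into U \<phi>))"

definition smooth_functions :: "('a, 'e::real_normed_vector) atlas \<Rightarrow> ('a \<Rightarrow> real) set" where
  "smooth_functions A = {f. \<forall>(U, \<phi>)\<in>A. smooth_on (\<phi> ` U) (f \<circ> inv_into U \<phi>)}"

text \<open>Smooth vector fields are the derivations of the algebra of smooth functions, normalised to
  vanish on non-smooth functions.\<close>

type_synonym 'a vector_field = "('a \<Rightarrow> real) \<Rightarrow> 'a \<Rightarrow> real"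

definition vector_fields :: "('a, 'e::real_normed_vector) atlas \<Rightarrow> 'a vector_field set" where
  "vector_fields A = {X.
     (\<forall>f\<in>smooth_functions A. X f \<in> smooth_functions A) \<and>
     linear_on (smooth_functions A) X \<and>
     (\<forall>f\<in>smooth_functions A. \<forall>h\<in>smooth_functions A. X (f * h) = f * X h + h * X f) \<and>
     (\<forall>f. f \<notin> smooth_functions A \<longrightarrow> X f = 0)}"

definition mult_field :: "('a \<Rightarrow> real) \<Rightarrow> 'a vector_field \<Rightarrow> 'a vector_field" where
  "mult_field f X = (\<lambda>h. f * X h)"

definition lie_bracket :: "'a vector_field \<Rightarrow> 'a vector_field \<Rightarrow> 'a vector_field" where
  "lie_bracket X Y = (\<lambda>f. X (Y f) - Y (X f))"

text \<open>Push-forward of a vector field along a diffeomorphism \<open>F\<close>.\<close>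

definition pushforward :: "('a \<Rightarrow> 'a) \<Rightarrow> 'a vector_field \<Rightarrow> 'a vector_field" where
  "pushforward F X = (\<lambda>f. X (f \<circ> F) \<circ> inv F)"


section \<open>Tensor fields and connections\<close>

text \<open>Tensor fields are given by \<open>C\<^sup>\<infinity>\<close>-multilinear maps on vector fields. The tangent vector of
  \<open>X\<close> at \<open>p\<close> is the derivation \<open>f \<mapsto> X f p\<close>; a metric has to be non-degenerate at every
  point \<open>p\<close>.\<close>

definition pseudo_riemannian_metric ::
    "('a, 'e::real_normed_vector) atlas \<Rightarrow>
     ('a vector_field \<Rightarrow> 'a vector_field \<Rightarrow> 'a \<Rightarrow> real) \<Rightarrow> bool" where
  "pseudo_riemannian_metric A g \<longleftrightarrow>
     (\<forall>X\<in>vector_fields A. \<forall>Y\<in>vector_fields A. g X Y \<in> smooth_functions A \<and> g X Y = g Y X) \<and>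
     (\<forall>X\<in>vector_fields A. \<forall>Y\<in>vector_fields A. \<forall>Z\<in>vector_fields A.
        g (X + Y) Z = g X Z + g Y Z) \<and>
     (\<forall>f\<in>smooth_functions A. \<forall>X\<in>vector_fields A. \<forall>Y\<in>vector_fields A.
        g (mult_field f X) Y = f * g X Y) \<and>
     (\<forall>p. \<forall>X\<in>vector_fields A.
        (\<forall>Y\<in>vector_fields A. g X Y p = 0) \<longrightarrow> (\<forall>f\<in>smooth_functions A. X f p = 0))"

definition three_form ::
    "('a, 'e::real_normed_vector) atlas \<Rightarrow>
     ('a vector_field \<Rightarrow> 'a vector_field \<Rightarrow> 'a vector_field \<Rightarrow> 'a \<Rightarrow> real) \<Rightarrow> bool" where
  "three_form A H \<longleftrightarrow>
     (\<forall>X\<in>vector_fields A. \<forall>Y\<in>vector_fields A. \<forall>Z\<in>vector_fields A.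
        H X Y Z \<in> smooth_functions A \<and> H X Y Z = - H Y X Z \<and> H X Y Z = - H X Z Y) \<and>
     (\<forall>X\<in>vector_fields A. \<forall>X'\<in>vector_fields A. \<forall>Y\<in>vector_fields A. \<forall>Z\<in>vector_fields A.
        H (X + X') Y Z = H X Y Z + H X' Y Z) \<and>
     (\<forall>f\<in>smooth_functions A. \<forall>X\<in>vector_fields A. \<forall>Y\<in>vector_fields A. \<forall>Z\<in>vector_fields A.
        H (mult_field f X) Y Z = f * H X Y Z)"

text \<open>Closedness is expressed by the invariant formula for the exterior derivative.\<close>

definition exterior_derivative3 ::
    "('a vector_field \<Rightarrow> 'a vector_field \<Rightarrow> 'a vector_field \<Rightarrow> 'a \<Rightarrow> real) \<Rightarrow>
     'a vector_field \<Rightarrow> 'a vector_field \<Rightarrow> 'a vector_field \<Rightarrow> 'a vector_field \<Rightarrow> 'a \<Rightarrow> real" where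
  "exterior_derivative3 H W X Y Z =
     W (H X Y Z) - X (H W Y Z) + Y (H W X Z) - Z (H W X Y)
     - H (lie_bracket W X) Y Z + H (lie_bracket W Y) X Z - H (lie_bracket W Z) X Y
     - H (lie_bracket X Y) W Z + H (lie_bracket X Z) W Y - H (lie_bracket Y Z) W X"

definition closed_form3 ::
    "('a, 'e::real_normed_vector) atlas \<Rightarrow>
     ('a vector_field \<Rightarrow> 'a vector_field \<Rightarrow> 'a vector_field \<Rightarrow> 'a \<Rightarrow> real) \<Rightarrow> bool" where
  "closed_form3 A H \<longleftrightarrow>
     (\<forall>W\<in>vector_fields A. \<forall>X\<in>vector_fields A. \<forall>Y\<in>vector_fields A. \<forall>Z\<in>vector_fields A.
        exterior_derivative3 H W X Y Z = 0)"

definition affine_connection ::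
    "('a, 'e::real_normed_vector) atlas \<Rightarrow>
     ('a vector_field \<Rightarrow> 'a vector_field \<Rightarrow> 'a vector_field) \<Rightarrow> bool" where
  "affine_connection A nabla \<longleftrightarrow>
     (\<forall>X\<in>vector_fields A. \<forall>Y\<in>vector_fields A. nabla X Y \<in> vector_fields A) \<and>
     (\<forall>X\<in>vector_fields A. \<forall>Y\<in>vector_fields A. \<forall>Z\<in>vector_fields A.
        nabla (X + Y) Z = nabla X Z + nabla Y Z \<and> nabla X (Y + Z) = nabla X Y + nabla X Z) \<and>
     (\<forall>f\<in>smooth_functions A. \<forall>X\<in>vector_fields A. \<forall>Y\<in>vector_fields A.
        nabla (mult_field f X) Y = mult_field f (nabla X Y) \<and>
        nabla X (mult_field f Y) = mult_field (X f) Y + mult_field f (nabla X Y))"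

definition levi_civita_connection ::
    "('a, 'e::real_normed_vector) atlas \<Rightarrow>
     ('a vector_field \<Rightarrow> 'a vector_field \<Rightarrow> 'a \<Rightarrow> real) \<Rightarrow>
     ('a vector_field \<Rightarrow> 'a vector_field \<Rightarrow> 'a vector_field) \<Rightarrow> bool" where
  "levi_civita_connection A g nabla \<longleftrightarrow>
     affine_connection A nabla \<and>
     (\<forall>X\<in>vector_fields A. \<forall>Y\<in>vector_fields A. nabla X Y - nabla Y X = lie_bracket X Y) \<and>
     (\<forall>X\<in>vector_fields A. \<forall>Y\<in>vector_fields A. \<forall>Z\<in>vector_fields A.
        X (g Y Z) = g (nabla X Y) Z + g Y (nabla X Z))"


section \<open>Lie groups\<close>

text \<open>A Lie group: the type \<open>'a\<close> with atlas \<open>A\<close>, multiplication \<open>m\<close>, neutral element \<open>e\<close> and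
  inversion \<open>i\<close>.\<close>

definition lie_group ::
    "('a::{t2_space,second_countable_topology}, 'e::real_inner) atlas \<Rightarrow>
     ('a \<Rightarrow> 'a \<Rightarrow> 'a) \<Rightarrow> 'a \<Rightarrow> ('a \<Rightarrow> 'a) \<Rightarrow> bool" where
  "lie_group A m e i \<longleftrightarrow>
     smooth_atlas A \<and> Groups.group m e i \<and>
     smooth_map (prod_atlas A A) A (\<lambda>(x, y). m x y) \<and> smooth_map A A i"

text \<open>The Lie algebra of left-invariant vector fields; \<open>m a\<close> is the left translation by \<open>a\<close>.\<close>

definition lie_algebra ::
    "('a, 'e::real_normed_vector) atlas \<Rightarrow> ('a \<Rightarrow> 'a \<Rightarrow> 'a) \<Rightarrow> 'a vector_field set" where
  "lie_algebra A m = {X \<in> vector_fields A. \<forall>a. pushforward (m a) X = X}"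

definition left_invariant_metric ::
    "('a, 'e::real_normed_vector) atlas \<Rightarrow> ('a \<Rightarrow> 'a \<Rightarrow> 'a) \<Rightarrow>
     ('a vector_field \<Rightarrow> 'a vector_field \<Rightarrow> 'a \<Rightarrow> real) \<Rightarrow> bool" where
  "left_invariant_metric A m g \<longleftrightarrow>
     (\<forall>a. \<forall>X\<in>vector_fields A. \<forall>Y\<in>vector_fields A.
        g (pushforward (m a) X) (pushforward (m a) Y) \<circ> m a = g X Y)"

definition left_invariant_form3 ::
    "('a, 'e::real_normed_vector) atlas \<Rightarrow> ('a \<Rightarrow> 'a \<Rightarrow> 'a) \<Rightarrow>
     ('a vector_field \<Rightarrow> 'a vector_field \<Rightarrow> 'a vector_field \<Rightarrow> 'a \<Rightarrow> real) \<Rightarrow> bool" where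
  "left_invariant_form3 A m H \<longleftrightarrow>
     (\<forall>a. \<forall>X\<in>vector_fields A. \<forall>Y\<in>vector_fields A. \<forall>Z\<in>vector_fields A.
        H (pushforward (m a) X) (pushforward (m a) Y) (pushforward (m a) Z) \<circ> m a = H X Y Z)"

definition trace_form ::
    "('a, 'e::real_normed_vector) atlas \<Rightarrow> ('a \<Rightarrow> 'a \<Rightarrow> 'a) \<Rightarrow> 'a vector_field \<Rightarrow> real" where
  "trace_form A m X = trace_on (lie_algebra A m) (\<lambda>Y. lie_bracket X Y)"

definition unimodular :: "('a, 'e::real_normed_vector) atlas \<Rightarrow> ('a \<Rightarrow> 'a \<Rightarrow> 'a) \<Rightarrow> bool" where
  "unimodular A m \<longleftrightarrow> (\<forall>X\<in>lie_algebra A m. trace_form A m X = 0)"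


section \<open>Generalized pseudo-Riemannian Lie groups\<close>

text \<open>The elements \<open>X + \<xi>\<close> of \<open>E = \<gg> \<oplus> \<gg>*\<close> are represented by pairs \<open>(X, \<xi>)\<close>.\<close>

type_synonym 'a generalized_section = "'a vector_field \<times> ('a vector_field \<Rightarrow> real)"

definition generalized_algebra ::
    "('a, 'e::real_normed_vector) atlas \<Rightarrow> ('a \<Rightarrow> 'a \<Rightarrow> 'a) \<Rightarrow> 'a generalized_section set" where
  "generalized_algebra A m = lie_algebra A m \<times> dual_on (lie_algebra A m)"

definition pairing :: "'a generalized_section \<Rightarrow> 'a generalized_section \<Rightarrow> real" where
  "pairing u v = (snd u (fst v) + snd v (fst u)) / 2"

text \<open>The endomorphism \<open>\<G>\<^bsup>end\<^esup>\<close> of \<open>E\<close>.\<close>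

definition generalized_end ::
    "('a, 'e::real_normed_vector) atlas \<Rightarrow> ('a \<Rightarrow> 'a \<Rightarrow> 'a) \<Rightarrow>
     ('a generalized_section \<Rightarrow> 'a generalized_section \<Rightarrow> real) \<Rightarrow>
     'a generalized_section \<Rightarrow> 'a generalized_section" where
  "generalized_end A m \<G> u =
     (THE w. w \<in> generalized_algebra A m \<and> (\<forall>v\<in>generalized_algebra A m. pairing w v = \<G> u v))"

definition restrict_to_dual ::
    "('a generalized_section \<Rightarrow> 'a generalized_section \<Rightarrow> real) \<Rightarrow>
     ('a vector_field \<Rightarrow> real) \<Rightarrow> ('a vector_field \<Rightarrow> real) \<Rightarrow> real" where
  "restrict_to_dual \<G> \<xi> \<eta> = \<G> (0, \<xi>) (0, \<eta>)"

definition generalized_pseudo_riemannian_lie_group ::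
    "('a::{t2_space,second_countable_topology}, 'e::real_inner) atlas \<Rightarrow>
     ('a \<Rightarrow> 'a \<Rightarrow> 'a) \<Rightarrow> 'a \<Rightarrow> ('a \<Rightarrow> 'a) \<Rightarrow>
     ('a vector_field \<Rightarrow> 'a vector_field \<Rightarrow> 'a vector_field \<Rightarrow> 'a \<Rightarrow> real) \<Rightarrow>
     ('a generalized_section \<Rightarrow> 'a generalized_section \<Rightarrow> real) \<Rightarrow> bool" where
  "generalized_pseudo_riemannian_lie_group A m e i H \<G> \<longleftrightarrow>
     lie_group A m e i \<and>
     three_form A H \<and> closed_form3 A H \<and> left_invariant_form3 A m H \<and>
     bilinear_form_on (generalized_algebra A m) \<G> \<and> symmetric_on (generalized_algebra A m) \<G> \<and>
     (\<forall>u\<in>generalized_algebra A m. generalized_end A m \<G> (generalized_end A m \<G> u) = u) \<and>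
     nondegenerate_on (dual_on (lie_algebra A m)) (restrict_to_dual \<G>)"

text \<open>\<open>g\<close> is the left-invariant metric with \<open>\<G>(\<xi>, \<eta>) = g\<^sup>-\<^sup>1(\<xi>, \<eta>) / 2\<close>. The functions \<open>g X Y\<close> are
  constant for \<open>X, Y \<in> \<gg>\<close>, so the induced scalar product on \<open>\<gg>\<close> may be evaluated at \<open>e\<close>.\<close>

definition associated_metric ::
    "('a, 'e::real_normed_vector) atlas \<Rightarrow> ('a \<Rightarrow> 'a \<Rightarrow> 'a) \<Rightarrow> 'a \<Rightarrow>
     ('a generalized_section \<Rightarrow> 'a generalized_section \<Rightarrow> real) \<Rightarrow>
     ('a vector_field \<Rightarrow> 'a vector_field \<Rightarrow> 'a \<Rightarrow> real) \<Rightarrow> bool" where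
  "associated_metric A m e \<G> g \<longleftrightarrow>
     pseudo_riemannian_metric A g \<and> left_invariant_metric A m g \<and>
     (\<exists>h. inverse_form_on (lie_algebra A m) (\<lambda>X Y. g X Y e) h \<and>
          (\<forall>\<xi>\<in>dual_on (lie_algebra A m). \<forall>\<eta>\<in>dual_on (lie_algebra A m).
             restrict_to_dual \<G> \<xi> \<eta> = 1 / 2 * h \<xi> \<eta>))"

text \<open>\<open>\<delta>(v) = tr (Y \<mapsto> \<nabla>\<^bsub>Y\<^esub> \<pi>(v))\<close>, where \<open>\<pi>\<close> is the first projection.\<close>

definition riemannian_divergence ::
    "('a, 'e::real_normed_vector) atlas \<Rightarrow> ('a \<Rightarrow> 'a \<Rightarrow> 'a) \<Rightarrow>
     ('a vector_field \<Rightarrow> 'a vector_field \<Rightarrow> 'a vector_field) \<Rightarrow> 'a generalized_section \<Rightarrow> real" where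
  "riemannian_divergence A m nabla v = trace_on (lie_algebra A m) (\<lambda>Y. nabla Y (fst v))"

end

theory Submission
  imports Defs
begin

text \<open>Torsion-freeness gives \<open>\<nabla>\<^bsub>Y\<^esub> X = \<nabla>\<^bsub>X\<^esub> Y - [X, Y]\<close>. For \<open>X \<in> \<gg>\<close> the endomorphism
  \<open>\<nabla>\<^bsub>X\<^esub>\<close> of \<open>\<gg>\<close> is skew with respect to \<open>g\<close>, because \<open>g\<close> is constant on left-invariant fields,
  and hence has trace zero; so \<open>tr (Y \<mapsto> \<nabla>\<^bsub>Y\<^esub> X) = - tr ad\<^bsub>X\<^esub>\<close>. That \<open>\<nabla>\<^bsub>X\<^esub>\<close> preserves \<open>\<gg>\<close>
  follows from the Koszul formula. If \<open>\<gg>\<close> had no finite basis, both traces would be \<open>0\<close> by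
  convention, so finite-dimensionality of \<open>\<gg>\<close> does not have to be proved.\<close>

section \<open>Calculus of \<open>C\<^sup>k\<close> functions\<close>

text \<open>\<open>C_on\<close> recurses through the chosen \<open>frechet_derivative\<close>,
  whereas a concrete derivative \<open>D\<close> agrees with it only on \<open>S\<close>. Congruence
  is a premise so that the rule already serves inside the induction for \<open>C_on_cong\<close>,
  with the induction hypothesis in its place; \<open>C_on_open_SucI\<close> discharges it
  afterwards.\<close>

lemma C_on_SucI:
  fixes f :: "'a::real_normed_vector \<Rightarrow> 'b::real_normed_vector"
  assumes D: "\<And>x. x \<in> S \<Longrightarrow> (f has_derivative D x) (at x)"
    and C: "\<And>v. C_on k S (\<lambda>x. D x v)"
    and cong: "\<And>g h :: 'a \<Rightarrow> 'b.
      (\<And>x. x \<in> S \<Longrightarrow> g x = h x) \<Longrightarrow> C_on k S g \<Longrightarrow> C_on k S h"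
  shows "C_on (Suc k) S f"
proof -
  have "D x v = frechet_derivative f (at x) v" if "x \<in> S" for x v
    using frechet_derivative_at[OF D[OF that]] by simp
  then have "C_on k S (\<lambda>x. frechet_derivative f (at x) v)" for v
    by (rule cong[OF _ C])
  then show ?thesis
    using D by (auto simp: differentiable_def)
qed

lemma C_on_SucD:
  assumes "C_on (Suc k) S f"
  shows "x \<in> S \<Longrightarrow> (f has_derivative frechet_derivative f (at x)) (at x)"
    and "C_on k S (\<lambda>x. frechet_derivative f (at x) v)"
  using assms frechet_derivative_works by auto

text \<open>Openness of \<open>S\<close> matters because \<open>C_on\<close> takes derivatives in
  full neighbourhoods, so agreement at the points of \<open>S\<close> has to be agreement near each
  of them.\<close>

lemma C_on_cong:
  assumes "open S" and "\<And>x. x \<in> S \<Longrightarrow> f x = g x" and "C_on k S f"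
  shows "C_on k S g"
  using assms(2,3)
proof (induction k arbitrary: f g)
  case 0
  then show ?case
    using continuous_on_cong[of S S f g] by simp
next
  case (Suc k)
  show ?case
  proof (rule C_on_SucI[OF _ C_on_SucD(2)[OF Suc.prems(2)] Suc.IH])
    show "(g has_derivative frechet_derivative f (at x)) (at x)" if "x \<in> S" for x
      using has_derivative_transform_within_open[OF C_on_SucD(1)[OF Suc.prems(2) that]
        \<open>open S\<close> that Suc.prems(1)] .
  qed auto
qed

lemmas C_on_open_SucI = C_on_SucI[OF _ _ C_on_cong]

lemma C_on_mono:
  assumes "C_on k T f" and "S \<subseteq> T"
  shows "C_on k S f"
  using assms by (induction k arbitrary: f) (auto intro: continuous_on_subset)

text \<open>Being of class \<open>C^k\<close> is a local property; this glues the regularity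
  obtained chart by chart.\<close>

lemma C_on_Union:
  assumes "\<And>S. S \<in> \<S> \<Longrightarrow> open S" and "\<And>S. S \<in> \<S> \<Longrightarrow> C_on k S f"
  shows "C_on k (\<Union>\<S>) f"
  using assms(2)
proof (induction k arbitrary: f)
  case 0
  then show ?case
    using assms(1) by (simp add: continuous_on_open_Union)
next
  case (Suc k)
  then show ?case
    by auto
qed

lemma C_on_Suc_imp:
  assumes "C_on (Suc k) S f"
  shows "C_on k S f"
  using assms
proof (induction k arbitrary: f)
  case 0
  then show ?case
    by (auto intro!: continuous_at_imp_continuous_on differentiable_imp_continuous_within)
qed auto

lemma C_on_const:
  assumes "open S"
  shows "C_on k S (\<lambda>x. c)"
proof (induction k arbitrary: c)
  case (Suc k)
  then show ?case
    by (intro C_on_open_SucI[where D = "\<lambda>x v. 0"] assms) auto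
qed auto

lemma C_on_linear:
  assumes "open S" and L: "bounded_linear L" and "C_on k S f"
  shows "C_on k S (\<lambda>x. L (f x))"
  using assms(3)
proof (induction k arbitrary: f)
  case 0
  then show ?case
    by (auto intro: bounded_linear.continuous_on[OF L])
next
  case (Suc k)
  show ?case
    using bounded_linear.has_derivative[OF L C_on_SucD(1)[OF Suc.prems]]
      Suc.IH[OF C_on_SucD(2)[OF Suc.prems]]
    by (rule C_on_open_SucI[OF _ _ \<open>open S\<close>])
qed

lemma C_on_add:
  assumes "open S" and "C_on k S f" and "C_on k S g"
  shows "C_on k S (\<lambda>x. f x + g x)"
  using assms(2,3)
proof (induction k arbitrary: f g)
  case 0
  then show ?case
    by (auto intro!: continuous_on_add continuous_on_scaleR)
next
  case (Suc k)
  show ?case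
    using has_derivative_add[OF C_on_SucD(1)[OF Suc.prems(1)] C_on_SucD(1)[OF Suc.prems(2)]]
      Suc.IH[OF C_on_SucD(2)[OF Suc.prems(1)] C_on_SucD(2)[OF Suc.prems(2)]]
    by (rule C_on_open_SucI[OF _ _ \<open>open S\<close>])
qed

lemma C_on_diff:
  assumes "open S" and "C_on k S f" and "C_on k S g"
  shows "C_on k S (\<lambda>x. f x - g x)"
  using C_on_add[OF assms(1,2) C_on_linear[OF assms(1) _ assms(3), of uminus]]
    bounded_linear_minus[OF bounded_linear_ident] by simp

lemma C_on_sum:
  assumes "open S" and "finite B" and "\<And>b. b \<in> B \<Longrightarrow> C_on k S (f b)"
  shows "C_on k S (\<lambda>x. \<Sum>b\<in>B. f b x)"
  using assms(2,3) by (induction B) (auto intro: C_on_add C_on_const \<open>open S\<close>)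

lemma C_on_scaleR:
  assumes "open S" and "C_on k S f" and "C_on k S g"
  shows "C_on k S (\<lambda>x. f x *\<^sub>R g x)"
  using assms(2,3)
proof (induction k arbitrary: f g)
  case 0
  then show ?case
    by (auto intro!: continuous_on_add continuous_on_scaleR)
next
  case (Suc k)
  note f = Suc.prems(1) and g = Suc.prems(2)
  define D where "D x v = f x *\<^sub>R frechet_derivative g (at x) v
      + frechet_derivative f (at x) v *\<^sub>R g x" for x v
  have "((\<lambda>x. f x *\<^sub>R g x) has_derivative D x) (at x)" if "x \<in> S" for x
    using has_derivative_scaleR[OF C_on_SucD(1)[OF f that] C_on_SucD(1)[OF g that]]
    unfolding D_def .
  moreover have "C_on k S (\<lambda>x. D x v)" for v
    \<comment> \<open>The product rule brings back \<open>f\<close> and \<open>g\<close>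
      undifferentiated, so they must first be lowered from class \<open>Suc k\<close> to class
      \<open>k\<close>.\<close>
    unfolding D_def
    by (intro C_on_add \<open>open S\<close> Suc.IH C_on_SucD(2)[OF f] C_on_SucD(2)[OF g]
        C_on_Suc_imp[OF f] C_on_Suc_imp[OF g])
  ultimately show ?case
    by (rule C_on_open_SucI[OF _ _ \<open>open S\<close>])
qed

section \<open>The chain rule and restriction to slices\<close>

lemma orthonormal_expansion:
  assumes "finite B" and orth: "\<forall>u\<in>B. \<forall>v\<in>B. u \<bullet> v = (if u = v then 1 else 0)"
    and "x \<in> span B"
  shows "x = (\<Sum>b\<in>B. (x \<bullet> b) *\<^sub>R b)"
  using \<open>x \<in> span B\<close>
proof (induction rule: span_induct_alt)
  case base
  show ?case by simp
next
  case (step c u y)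
  have "(\<Sum>b\<in>B. ((c *\<^sub>R u + y) \<bullet> b) *\<^sub>R b)
      = c *\<^sub>R (\<Sum>b\<in>B. (u \<bullet> b) *\<^sub>R b) + (\<Sum>b\<in>B. (y \<bullet> b) *\<^sub>R b)"
    by (simp add: inner_add_left scaleR_add_left sum.distrib scaleR_sum_right)
  also have "(\<Sum>b\<in>B. (u \<bullet> b) *\<^sub>R b) = (\<Sum>b\<in>B. if b = u then u else 0)"
    using orth step.hyps by (intro sum.cong) auto
  finally show ?case
    using step \<open>finite B\<close> by simp
qed

text \<open>In the chain rule \<open>f'(F x)(F'(x) v)\<close> the base point and the direction both
  vary with \<open>x\<close>, so the induction hypothesis does not apply as it stands. Expanding the
  direction in the orthonormal basis \<open>B\<close> gives a finite sum of scalar coefficients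
  times directional derivatives of \<open>f\<close> composed with \<open>F\<close>, to which it does
  apply.\<close>

lemma C_on_compose:
  fixes F :: "'a::real_normed_vector \<Rightarrow> 'b::real_inner" and f :: "'b \<Rightarrow> 'c::real_normed_vector"
  assumes "open S" and "F ` S \<subseteq> T"
    and B: "finite (B :: 'b set)" "\<forall>u\<in>B. \<forall>v\<in>B. u \<bullet> v = (if u = v then 1 else 0)" "span B = UNIV"
    and "C_on k S F" and "C_on k T f"
  shows "C_on k S (\<lambda>x. f (F x))"
  using assms(6,7)
proof (induction k arbitrary: f)
  case 0
  then show ?case
    using \<open>F ` S \<subseteq> T\<close> by (auto intro: continuous_on_compose2)
next
  case (Suc k)
  note F = Suc.prems(1) and f = Suc.prems(2)
  define D where "D = (\<lambda>x v. \<Sum>b\<in>B. (frechet_derivative F (at x) v \<bullet> b) *\<^sub>R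
      frechet_derivative f (at (F x)) b)"
  have "((\<lambda>x. f (F x)) has_derivative D x) (at x)" if "x \<in> S" for x
  proof -
    have f': "(f has_derivative frechet_derivative f (at (F x))) (at (F x))"
      using C_on_SucD(1)[OF f] \<open>F ` S \<subseteq> T\<close> that by auto
    then interpret linear "frechet_derivative f (at (F x))"
      by (rule has_derivative_linear)
    have "frechet_derivative f (at (F x)) w
        = (\<Sum>b\<in>B. (w \<bullet> b) *\<^sub>R frechet_derivative f (at (F x)) b)" for w
    proof -
      have "w = (\<Sum>b\<in>B. (w \<bullet> b) *\<^sub>R b)"
        using B(3) by (intro orthonormal_expansion B(1,2)) auto
      then have "frechet_derivative f (at (F x)) w
          = frechet_derivative f (at (F x)) (\<Sum>b\<in>B. (w \<bullet> b) *\<^sub>R b)"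
        by (rule arg_cong)
      then show ?thesis
        by (simp only: sum scale)
    qed
    then have "D x = (\<lambda>v. frechet_derivative f (at (F x)) (frechet_derivative F (at x) v))"
      unfolding D_def by (intro ext) (rule sym)
    then show ?thesis
      using has_derivative_compose[OF C_on_SucD(1)[OF F that] f'] by simp
  qed
  moreover have "C_on k S (\<lambda>x. D x v)" for v
    unfolding D_def
  proof (intro C_on_sum C_on_scaleR \<open>open S\<close> B(1))
    show "C_on k S (\<lambda>x. frechet_derivative F (at x) v \<bullet> b)" for b
      using C_on_linear[OF \<open>open S\<close> bounded_linear_inner_left C_on_SucD(2)[OF F]] .
    show "C_on k S (\<lambda>x. frechet_derivative f (at (F x)) b)" for b
      using Suc.IH[OF C_on_Suc_imp[OF F] C_on_SucD(2)[OF f]] .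
  qed
  ultimately show ?case
    by (rule C_on_open_SucI[OF _ _ \<open>open S\<close>])
qed

text \<open>Along a slice the direction \<open>(0, v)\<close> is constant, so each derivative is
  again a slice of a directional derivative of \<open>f\<close>, and no basis of the product space
  enters.\<close>

lemma C_on_Pair_left:
  assumes "open S" and "Pair c ` S \<subseteq> T" and "C_on k T f"
  shows "C_on k S (\<lambda>x. f (c, x))"
  using assms(3)
proof (induction k arbitrary: f)
  case 0
  then show ?case
    using \<open>Pair c ` S \<subseteq> T\<close> by (auto intro!: continuous_on_compose2[of T f] continuous_intros)
next
  case (Suc k)
  have "((\<lambda>x. f (c, x)) has_derivative (\<lambda>v. frechet_derivative f (at (c, x)) (0, v))) (at x)"
    if "x \<in> S" for x
    using that \<open>Pair c ` S \<subseteq> T\<close>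
    by (intro has_derivative_compose[OF _ C_on_SucD(1)[OF Suc.prems]] has_derivative_Pair
        has_derivative_const has_derivative_ident) auto
  then show ?case
    using Suc.IH[OF C_on_SucD(2)[OF Suc.prems]]
    by (rule C_on_open_SucI[OF _ _ \<open>open S\<close>])
qed

section \<open>Traces of skew endomorphisms\<close>

lemma linear_on_sum_scaleR:
  assumes f: "linear_on V f" and V: "subspace V" and "finite B" and "B \<subseteq> V"
  shows "f (\<Sum>b\<in>B. a b *\<^sub>R b) = (\<Sum>b\<in>B. a b *\<^sub>R f b)"
  using assms(3,4)
proof (induction B)
  case empty
  have "f (0 *\<^sub>R 0) = 0 *\<^sub>R f 0"
    using f subspace_0[OF V] unfolding linear_on_def by blast
  then show ?case by simp
next
  case (insert b B)
  then have "(\<Sum>b\<in>B. a b *\<^sub>R b) \<in> V" "a b *\<^sub>R b \<in> V"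
    using V by (auto intro!: subspace_sum subspace_scale)
  then show ?case
    using insert f unfolding linear_on_def by simp
qed

lemma linear_on_representation:
  assumes "independent B"
  shows "linear_on (span B) (\<lambda>y. representation B y c)"
  using assms by (simp add: linear_on_def representation_add representation_scale)

text \<open>If \<open>b x\<close> vanishes on \<open>V\<close>, its flat is \<open>0\<close>, so
  every functional \<open>\<eta>\<close> satisfies \<open>\<eta> x = h 0 \<eta> = 0\<close>.
  Coordinate functionals of a basis then force \<open>x = 0\<close>.\<close>

lemma nondegenerate_on_of_inverse_form:
  assumes B: "finite B" "independent B" "span B = V" and h: "inverse_form_on V b h"
  shows "nondegenerate_on V b"
  unfolding nondegenerate_on_def
proof (intro ballI impI)
  fix x assume x: "x \<in> V" and b0: "\<forall>y\<in>V. b x y = 0"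
  then have flat: "flat_on V b x = 0"
    by (auto simp: flat_on_def)
  have zero: "0 \<in> dual_on V"
    by (simp add: dual_on_def linear_on_def)
  have "\<eta> x = 0" if \<eta>: "\<eta> \<in> dual_on V" for \<eta>
  proof -
    have "linear_on (dual_on V) (\<lambda>\<xi>. h \<xi> \<eta>)"
      using h \<eta> unfolding inverse_form_on_def bilinear_form_on_def by blast
    then have "h (0 *\<^sub>R 0) \<eta> = 0 *\<^sub>R h 0 \<eta>"
      using zero unfolding linear_on_def by blast
    then have "h 0 \<eta> = 0" by simp
    moreover have "h (flat_on V b x) \<eta> = \<eta> x"
      using h x \<eta> unfolding inverse_form_on_def by blast
    ultimately show ?thesis
      by (simp add: flat)
  qed
  \<comment> \<open>\<open>representation B y\<close> is \<open>0\<close> by default for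
    \<open>y\<close> outside \<open>span B\<close>, which matches the normalisation in
    \<open>dual_on\<close>.\<close>
  moreover have "(\<lambda>y. representation B y c) \<in> dual_on V" for c
    using B linear_on_representation[OF B(2), of c] by (auto simp: dual_on_def representation_def)
  ultimately have "representation B x c = 0" for c
    by blast
  then show "x = 0"
    using sum_representation_eq[OF B(2), of x B] x B by simp
qed

text \<open>The map \<open>F\<close> with coordinates \<open>b x c\<close> is injective on
  \<open>V\<close> by non-degeneracy, hence onto \<open>V\<close> by counting dimensions;
  \<open>d c\<close> is a preimage of \<open>c\<close>.\<close>

lemma dual_basis_exists:
  fixes b :: "'v::real_vector \<Rightarrow> 'v \<Rightarrow> real"
  assumes B: "finite B" "independent B" "span B = V"
    and b: "bilinear_form_on V b" and nondeg: "nondegenerate_on V b"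
  obtains d where "\<And>c. c \<in> B \<Longrightarrow> d c \<in> V"
    and "\<And>c c'. c \<in> B \<Longrightarrow> c' \<in> B \<Longrightarrow> b (d c) c' = (if c = c' then 1 else 0)"
proof -
  have V: "subspace V" "B \<subseteq> V"
    using B span_superset by auto
  define F where "F x = (\<Sum>c\<in>B. b x c *\<^sub>R c)" for x
  \<comment> \<open>\<open>F\<close> is known to be linear only on \<open>V\<close>;
    \<open>G\<close> is a globally linear map agreeing with it there, so that results on
    \<open>linear\<close> maps apply.\<close>
  define G where "G = construct B F"
  have G: "linear G"
    unfolding G_def by (rule linear_construct[OF B(2)])
  have GB: "G c = F c" if "c \<in> B" for c
    unfolding G_def by (rule construct_basis[OF B(2) that])
  have expand: "(\<Sum>c\<in>B. representation B x c *\<^sub>R c) = x" if "x \<in> V" for x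
    using sum_representation_eq[OF B(2)] B that by auto
  have GF: "G x = F x" if "x \<in> V" for x
  proof -
    have lin: "linear_on V F"
      unfolding F_def linear_on_def
      using b V by (auto simp: bilinear_form_on_def linear_on_def scaleR_add_left sum.distrib
          scaleR_sum_right subset_iff)
    have "G x = (\<Sum>c\<in>B. representation B x c *\<^sub>R F c)"
      using expand[OF that] linear_sum[OF G, of "\<lambda>c. representation B x c *\<^sub>R c" B]
      by (simp add: linear_cmul[OF G] GB)
    also have "\<dots> = F x"
      using linear_on_sum_scaleR[OF lin V(1) B(1) V(2), of "representation B x"] expand[OF that] by auto
    finally show ?thesis .
  qed
  have rep_F: "representation B (F x) c = b x c" if "c \<in> B" for x c
  proof -
    have "representation B (F x) = (\<lambda>c. if c \<in> B then b x c else 0)"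
      unfolding F_def
      using B by (intro representation_eqI span_sum span_scale)
        (auto intro: span_base sum.mono_neutral_cong_left split: if_splits)
    then show ?thesis using that by simp
  qed
  have "inj_on G (span B)"
  proof (rule inj_onI)
    fix x y assume xy: "x \<in> span B" "y \<in> span B" "G x = G y"
    then have "F (x - y) = 0"
      using GF[of "x - y"] B V by (simp add: linear_diff[OF G] subspace_diff)
    then have zero: "b (x - y) c = 0" if "c \<in> B" for c
      using rep_F[OF that, of "x - y"] by (simp add: representation_zero)
    have xyV: "x - y \<in> V"
      using xy B V by (simp add: subspace_diff)
    have "b (x - y) z = 0" if "z \<in> V" for z
    proof -
      have "linear_on V (b (x - y))"
        using b xyV unfolding bilinear_form_on_def by blast
      from linear_on_sum_scaleR[OF this V(1) B(1) V(2), of "representation B z"]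
      show ?thesis
        using expand[OF that] V(2) zero by auto
    qed
    then show "x = y"
      using nondeg xyV unfolding nondegenerate_on_def by fastforce
  qed
  then have ind: "independent (G ` B)" and "inj_on G B"
    using linear_independent_injective_image[OF G B(2)] span_superset[of B]
    by (auto intro: inj_on_subset)
  then have card: "card (G ` B) = card B"
    by (simp add: card_image)
  have "F x \<in> span B" for x
    unfolding F_def by (intro span_sum span_scale span_base)
  then have sub: "G ` B \<subseteq> span B"
    using GF V(2) by (auto simp: image_subset_iff)
  \<comment> \<open>Otherwise a missing \<open>c\<close> would enlarge the image of \<open>B\<close>
    to \<open>card B + 1\<close> independent vectors inside \<open>span B\<close>.\<close>
  have "B \<subseteq> span (G ` B)"
  proof (rule ccontr)
    assume "\<not> B \<subseteq> span (G ` B)"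
    then obtain c where c: "c \<in> B" "c \<notin> span (G ` B)" by blast
    have "independent (insert c (G ` B))"
      using independent_insertI[OF c(2) ind] .
    then have "card (insert c (G ` B)) \<le> card B"
      using independent_span_bound[OF B(1), of "insert c (G ` B)"] sub c span_base by auto
    moreover have "c \<notin> G ` B"
      using c(2) span_base[of c "G ` B"] by auto
    ultimately show False
      using B(1) card by simp
  qed
  also have "span (G ` B) = G ` V"
    using linear_span_image[OF G, of B] B by simp
  finally have "\<exists>x\<in>V. F x = c" if "c \<in> B" for c
    using GF that by fastforce
  then obtain d where d: "\<And>c. c \<in> B \<Longrightarrow> d c \<in> V \<and> F (d c) = c"
    by metis
  show thesis
  proof (rule that)
    show "d c \<in> V" if "c \<in> B" for c using d that by blast
    show "b (d c) c' = (if c = c' then 1 else 0)" if "c \<in> B" "c' \<in> B" for c c'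
      using rep_F[OF that(2), of "d c"] d[OF that(1)] representation_basis[OF B(2) that(1)]
      by (simp add: eq_commute)
  qed
qed

text \<open>Expanding the dual basis \<open>d\<close> in \<open>B\<close> writes the trace as the contraction of the symmetric
  matrix \<open>b (d c) (d c')\<close> with the skew matrix \<open>b c' (T c)\<close>.\<close>

lemma trace_skew_eq_0:
  assumes B: "finite B" "independent B" "span B = V"
    and b: "bilinear_form_on V b" and sym: "symmetric_on V b" and nondeg: "nondegenerate_on V b"
    and T: "\<And>x. x \<in> V \<Longrightarrow> T x \<in> V"
    and skew: "\<And>x y. x \<in> V \<Longrightarrow> y \<in> V \<Longrightarrow> b (T x) y = - b x (T y)"
  shows "(\<Sum>c\<in>B. representation B (T c) c) = 0"
proof -
  obtain d where d: "\<And>c. c \<in> B \<Longrightarrow> d c \<in> V"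
    "\<And>c c'. c \<in> B \<Longrightarrow> c' \<in> B \<Longrightarrow> b (d c) c' = (if c = c' then 1 else 0)"
    using dual_basis_exists[OF B b nondeg] by blast
  have V: "subspace V" "B \<subseteq> V"
    using B span_superset by auto
  have expand: "(\<Sum>c\<in>B. representation B x c *\<^sub>R c) = x" if "x \<in> V" for x
    using sum_representation_eq[OF B(2)] B that by auto
  have rep: "representation B x c = b (d c) x" if "x \<in> V" "c \<in> B" for x c
  proof -
    have "linear_on V (b (d c))"
      using b d(1) \<open>c \<in> B\<close> unfolding bilinear_form_on_def by blast
    from linear_on_sum_scaleR[OF this V(1) B(1) V(2), of "representation B x"]
    show ?thesis
      using expand[OF that(1)] V(2) d(2)[OF that(2)] that(2) B(1)
      by (auto simp: if_distrib[of "(*) _"] cong: if_cong)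
  qed
  have left: "b y x = (\<Sum>c\<in>B. b (d c) y * b c x)" if "x \<in> V" "y \<in> V" for x y
  proof -
    have "linear_on V (\<lambda>y. b y x)"
      using b that unfolding bilinear_form_on_def by blast
    from linear_on_sum_scaleR[OF this V(1) B(1) V(2), of "representation B y"]
    show ?thesis
      using expand[OF that(2)] V(2) rep[OF that(2)] by auto
  qed
  define S where "S = (\<Sum>c\<in>B. \<Sum>c'\<in>B. b (d c) (d c') * b c' (T c))"
  have tr: "(\<Sum>c\<in>B. representation B (T c) c) = S"
    unfolding S_def
  proof (rule sum.cong[OF refl])
    fix c assume c: "c \<in> B"
    then have "representation B (T c) c = (\<Sum>c'\<in>B. b (d c') (d c) * b c' (T c))"
      using rep[of "T c" c] left[of "T c" "d c"] T V(2) d(1) by auto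
    also have "\<dots> = (\<Sum>c'\<in>B. b (d c) (d c') * b c' (T c))"
      using sym d(1) c unfolding symmetric_on_def by (intro sum.cong) auto
    finally show "representation B (T c) c = (\<Sum>c'\<in>B. b (d c) (d c') * b c' (T c))" .
  qed
  \<comment> \<open>Exchanging the two summation indices changes the sign of the skew factor only,
    so \<open>S = - S\<close>.\<close>
  have "S = (\<Sum>c\<in>B. \<Sum>c'\<in>B. b (d c') (d c) * b c (T c'))"
    unfolding S_def by (rule sum.swap)
  also have "\<dots> = (\<Sum>c\<in>B. \<Sum>c'\<in>B. - (b (d c) (d c') * b c' (T c)))"
  proof (intro sum.cong refl)
    fix c c' assume c: "c \<in> B" "c' \<in> B"
    then have "b (d c') (d c) = b (d c) (d c')" "b c' (T c) = b (T c) c'"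
      using sym d(1) T V(2) unfolding symmetric_on_def by blast+
    moreover have "b (T c) c' = - b c (T c')"
      using skew c V(2) by blast
    ultimately show "b (d c') (d c) * b c (T c') = - (b (d c) (d c') * b c' (T c))"
      by simp
  qed
  also have "\<dots> = - S"
    unfolding S_def by (simp add: sum_negf)
  finally show ?thesis
    using tr by simp
qed

section \<open>Push-forward of vector fields by left translations\<close>

lemma smooth_atlasD:
  assumes "smooth_atlas A"
  shows "(U, \<phi>) \<in> A \<Longrightarrow> open U" and "(U, \<phi>) \<in> A \<Longrightarrow> open (\<phi> ` U)"
    and "(U, \<phi>) \<in> A \<Longrightarrow> homeomorphism U (\<phi> ` U) \<phi> (inv_into U \<phi>)"
    and "\<exists>U \<phi>. (U, \<phi>) \<in> A \<and> p \<in> U"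
proof -
  have "p \<in> (\<Union>(U, \<phi>)\<in>A. U)"
    using assms unfolding smooth_atlas_def by simp
  then show "\<exists>U \<phi>. (U, \<phi>) \<in> A \<and> p \<in> U"
    by auto
qed (use assms in \<open>auto simp: smooth_atlas_def\<close>)

lemma chart_inj_on:
  assumes "smooth_atlas A" and "(U, \<phi>) \<in> A"
  shows "inj_on \<phi> U"
  by (rule inj_on_inverseI) (rule homeomorphism_apply1[OF smooth_atlasD(3)[OF assms]])

lemma open_chart_image:
  assumes A: "smooth_atlas A" and U: "(U, \<phi>) \<in> A" and "open W"
  shows "open (\<phi> ` (U \<inter> W))"
proof -
  have "openin (top_of_set (\<phi> ` U)) (\<phi> ` (U \<inter> W))"
    using \<open>open W\<close> by (intro homeomorphism_imp_open_map[OF smooth_atlasD(3)[OF A U]]) auto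
  then show ?thesis
    using openin_open_trans smooth_atlasD(2)[OF A U] by blast
qed

lemma smooth_functions_diff:
  assumes A: "smooth_atlas A" and "f \<in> smooth_functions A" and "h \<in> smooth_functions A"
  shows "f - h \<in> smooth_functions A"
  unfolding smooth_functions_def mem_Collect_eq
proof (intro ballI, clarify)
  fix U \<phi> assume U: "(U, \<phi>) \<in> A"
  have "C_on k (\<phi> ` U) (f \<circ> inv_into U \<phi>)" "C_on k (\<phi> ` U) (h \<circ> inv_into U \<phi>)" for k
    using assms U by (auto simp: smooth_functions_def smooth_on_def)
  from C_on_diff[OF smooth_atlasD(2)[OF A U] this]
  show "smooth_on (\<phi> ` U) ((f - h) \<circ> inv_into U \<phi>)"
    by (simp add: smooth_on_def comp_def fun_diff_def)
qed

lemma smooth_functions_const: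
  assumes "smooth_atlas A"
  shows "(\<lambda>_. c) \<in> smooth_functions A"
  using smooth_atlasD(2)[OF assms]
  by (auto simp: smooth_functions_def smooth_on_def comp_def intro: C_on_const)

text \<open>A chart domain \<open>U\<close> need not be mapped into a single chart. On the part
  \<open>W V\<close> of its image that \<open>F\<close> sends into \<open>V\<close>, the function
  factors through the coordinate expressions of \<open>F\<close> and \<open>f\<close>; these open
  parts cover the image of \<open>U\<close>.\<close>

lemma smooth_functions_compose:
  fixes A :: "('a::{t2_space,second_countable_topology}, 'e::real_inner) atlas"
  assumes A: "smooth_atlas A" and F: "smooth_map A A F" and f: "f \<in> smooth_functions A"
  shows "f \<circ> F \<in> smooth_functions A"
  unfolding smooth_functions_def mem_Collect_eq
proof (intro ballI, clarify)
  fix U \<phi> assume U: "(U, \<phi>) \<in> A"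
  obtain B :: "'e set" where B: "finite B" "\<forall>u\<in>B. \<forall>v\<in>B. u \<bullet> v = (if u = v then 1 else 0)"
      "span B = UNIV"
    using A unfolding smooth_atlas_def by (elim conjE exE) (rule that)
  define W where "W V = \<phi> ` (U \<inter> F -` V)" for V
  have "C_on k (\<phi> ` U) (f \<circ> F \<circ> inv_into U \<phi>)" for k
  proof -
    have open_W: "open (W V)" if "(V, \<psi>) \<in> A" for V \<psi>
    proof -
      have "open (F -` V)"
        using F smooth_atlasD(1)[OF A that] by (intro open_vimage) (auto simp: smooth_map_def)
      then show ?thesis
        unfolding W_def by (rule open_chart_image[OF A U])
    qed
    have on_W: "C_on k (W V) (f \<circ> F \<circ> inv_into U \<phi>)" if V: "(V, \<psi>) \<in> A" for V \<psi>
    proof -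
      have inv: "inv_into U \<phi> x \<in> U \<inter> F -` V" if "x \<in> W V" for x
        using that chart_inj_on[OF A U] by (auto simp: W_def)
      have "C_on k (W V) (\<psi> \<circ> F \<circ> inv_into U \<phi>)"
        using F U V by (fastforce simp: smooth_map_def smooth_on_def W_def)
      moreover have "C_on k (\<psi> ` V) (f \<circ> inv_into V \<psi>)"
        using f V by (auto simp: smooth_functions_def smooth_on_def)
      moreover have "(\<psi> \<circ> F \<circ> inv_into U \<phi>) ` W V \<subseteq> \<psi> ` V"
        using inv by auto
      ultimately have comp: "C_on k (W V) (\<lambda>x. (f \<circ> inv_into V \<psi>) ((\<psi> \<circ> F \<circ> inv_into U \<phi>) x))"
        using C_on_compose[OF open_W[OF V] _ B] by blast
      show ?thesis
        using inv chart_inj_on[OF A V] by (auto intro!: C_on_cong[OF open_W[OF V] _ comp])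
    qed
    have "C_on k (\<Union>{W V |V \<psi>. (V, \<psi>) \<in> A}) (f \<circ> F \<circ> inv_into U \<phi>)"
      using open_W on_W by (intro C_on_Union) blast+
    moreover have "\<phi> ` U \<subseteq> \<Union>{W V |V \<psi>. (V, \<psi>) \<in> A}"
    proof
      fix x assume "x \<in> \<phi> ` U"
      then obtain p where p: "p \<in> U" "x = \<phi> p" by blast
      obtain V \<psi> where "(V, \<psi>) \<in> A" "F p \<in> V"
        using smooth_atlasD(4)[OF A] by blast
      with p show "x \<in> \<Union>{W V |V \<psi>. (V, \<psi>) \<in> A}"
        unfolding W_def by blast
    qed
    ultimately show ?thesis
      by (rule C_on_mono)
  qed
  then show "smooth_on (\<phi> ` U) (f \<circ> F \<circ> inv_into U \<phi>)"
    by (simp add: smooth_on_def)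
qed

text \<open>Left translation by \<open>a\<close> is multiplication restricted to the slice with
  first factor \<open>a\<close>. In a product chart whose first factor is a chart around
  \<open>a\<close>, this fixes the first coordinate at \<open>\<phi>0 a\<close>.\<close>

lemma smooth_map_left_translation:
  assumes G: "lie_group A m e i"
  shows "smooth_map A A (m a)"
proof -
  have A: "smooth_atlas A" and mul: "smooth_map (prod_atlas A A) A (\<lambda>(x, y). m x y)"
    using G by (auto simp: lie_group_def)
  have cont: "continuous_on UNIV (m a)"
  proof -
    have "continuous_on UNIV (\<lambda>(x, y). m x y)"
      using mul by (simp add: smooth_map_def)
    then have "continuous_on UNIV (\<lambda>x. (\<lambda>(x, y). m x y) (a, x))"
      by (rule continuous_on_compose2) (auto intro: continuous_intros)
    then show ?thesis by simp
  qed
  obtain U0 \<phi>0 where U0: "(U0, \<phi>0) \<in> A" "a \<in> U0"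
    using smooth_atlasD(4)[OF A] by blast
  have "smooth_on (\<phi> ` (U \<inter> m a -` V)) (\<psi> \<circ> m a \<circ> inv_into U \<phi>)"
    if U: "(U, \<phi>) \<in> A" and V: "(V, \<psi>) \<in> A" for U \<phi> V \<psi>
    unfolding smooth_on_def
  proof
    fix k
    let ?S = "\<phi> ` (U \<inter> m a -` V)"
    let ?T = "map_prod \<phi>0 \<phi> ` ((U0 \<times> U) \<inter> (\<lambda>(x, y). m x y) -` V)"
    let ?h = "\<psi> \<circ> (\<lambda>(x, y). m x y) \<circ> inv_into (U0 \<times> U) (map_prod \<phi>0 \<phi>)"
    have "open (m a -` V)"
      by (rule open_vimage[OF smooth_atlasD(1)[OF A V] cont])
    then have S: "open ?S"
      by (rule open_chart_image[OF A U])
    have inj: "inj_on (map_prod \<phi>0 \<phi>) (U0 \<times> U)"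
      by (rule map_prod_inj_on[OF chart_inj_on[OF A U0(1)] chart_inj_on[OF A U]])
    have "(U0 \<times> U, map_prod \<phi>0 \<phi>) \<in> prod_atlas A A"
      using U U0 by (auto simp: prod_atlas_def)
    then have "smooth_on ?T ?h"
      using mul V unfolding smooth_map_def by fast
    then have "C_on k ?T ?h"
      by (simp add: smooth_on_def)
    moreover have "Pair (\<phi>0 a) ` ?S \<subseteq> ?T"
      using U0 by force
    ultimately have "C_on k ?S (\<lambda>x. ?h (\<phi>0 a, x))"
      by (rule C_on_Pair_left[OF S, rotated])
    then show "C_on k ?S (\<psi> \<circ> m a \<circ> inv_into U \<phi>)"
    proof (rule C_on_cong[OF S, rotated])
      show "?h (\<phi>0 a, x) = (\<psi> \<circ> m a \<circ> inv_into U \<phi>) x" if x: "x \<in> ?S" for x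
      proof -
        obtain p where p: "p \<in> U" "x = \<phi> p"
          using x by blast
        have "inv_into (U0 \<times> U) (map_prod \<phi>0 \<phi>) (map_prod \<phi>0 \<phi> (a, p)) = (a, p)"
          using inj U0 p by (intro inv_into_f_f) auto
        then show ?thesis
          using p chart_inj_on[OF A U] by simp
      qed
    qed
  qed
  then show ?thesis
    using cont by (auto simp: smooth_map_def)
qed

section \<open>Derivations and their push-forwards\<close>

lemma vector_field_diff:
  assumes "smooth_atlas A" and "X \<in> vector_fields A" and "Y \<in> vector_fields A"
  shows "X - Y \<in> vector_fields A"
  using assms smooth_functions_diff[OF assms(1)]
  by (simp add: vector_fields_def linear_on_def right_diff_distrib scaleR_diff_right)

text \<open>The Leibniz rule for \<open>1 = 1 * 1\<close> gives \<open>X 1 = X 1 + X 1\<close>, so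
  \<open>X 1 = 0\<close>; linearity does the rest.\<close>

lemma vector_field_const:
  assumes A: "smooth_atlas A" and X: "X \<in> vector_fields A"
  shows "X (\<lambda>_. c) = 0"
proof -
  have one: "1 \<in> smooth_functions A"
    using smooth_functions_const[OF A, of 1] by (simp add: one_fun_def)
  have "X (1 * 1) = 1 * X 1 + 1 * X 1"
    using X one unfolding vector_fields_def by blast
  then have "X 1 = 0" by simp
  moreover have "X (c *\<^sub>R 1) = c *\<^sub>R X 1"
    using X one unfolding vector_fields_def linear_on_def by blast
  moreover have "c *\<^sub>R 1 = (\<lambda>_::'a. c)"
    by (simp add: scaleR_fun_def one_fun_def)
  ultimately show ?thesis by simp
qed

lemma bij_comp_inv:
  assumes "bij F"
  shows "f \<circ> F \<circ> inv F = f" and "f \<circ> inv F \<circ> F = f"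
  using assms by (auto simp: fun_eq_iff bij_is_surj surj_f_inv_f bij_is_inj)

lemma pushforward_apply:
  assumes "bij F"
  shows "pushforward F X f \<circ> F = X (f \<circ> F)"
  by (simp only: pushforward_def bij_comp_inv[OF assms])

text \<open>The premise says that \<open>X\<close> and \<open>Y\<close> are
  \<open>F\<close>-related; this criterion keeps \<open>inv F\<close> out of later
  computations.\<close>

lemma pushforward_eqI:
  assumes "bij F" and "\<And>f. X (f \<circ> F) = Y f \<circ> F"
  shows "pushforward F X = Y"
  by (rule ext) (simp only: pushforward_def assms(2) bij_comp_inv[OF assms(1)])

text \<open>Composition with \<open>F\<close> is an automorphism of the algebra of smooth functions,
  and conjugating a derivation by it gives a derivation. That it also reflects smoothness preserves
  the value \<open>0\<close> on non-smooth functions.\<close>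

lemma pushforward_vector_field:
  assumes A: "smooth_atlas A" and "bij F" and F: "smooth_map A A F" and F': "smooth_map A A (inv F)"
    and X: "X \<in> vector_fields A"
  shows "pushforward F X \<in> vector_fields A"
proof -
  have iff: "f \<circ> F \<in> smooth_functions A \<longleftrightarrow> f \<in> smooth_functions A" for f
  proof
    assume "f \<circ> F \<in> smooth_functions A"
    from smooth_functions_compose[OF A F' this]
    show "f \<in> smooth_functions A"
      by (simp only: bij_comp_inv[OF \<open>bij F\<close>])
  qed (rule smooth_functions_compose[OF A F])
  have comp: "(f + h) \<circ> k = (f \<circ> k) + (h \<circ> k)" "(f * h) \<circ> k = (f \<circ> k) * (h \<circ> k)"
    "(c *\<^sub>R f) \<circ> k = c *\<^sub>R (f \<circ> k)" "0 \<circ> k = 0"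
    for f h :: "'a \<Rightarrow> real" and k :: "'a \<Rightarrow> 'a" and c :: real
    by (auto simp: scaleR_fun_def)
  show ?thesis
    using X unfolding vector_fields_def linear_on_def pushforward_def
    by (simp add: comp iff bij_comp_inv[OF \<open>bij F\<close>] smooth_functions_compose[OF A F'])
qed

lemma pushforward_bracket:
  assumes "bij F"
  shows "pushforward F (lie_bracket X Y) = lie_bracket (pushforward F X) (pushforward F Y)"
proof (rule pushforward_eqI[OF assms])
  fix f
  have "lie_bracket (pushforward F X) (pushforward F Y) f \<circ> F
      = (pushforward F X (pushforward F Y f) \<circ> F) - (pushforward F Y (pushforward F X f) \<circ> F)"
    by (simp add: lie_bracket_def fun_eq_iff)
  then show "lie_bracket X Y (f \<circ> F) = lie_bracket (pushforward F X) (pushforward F Y) f \<circ> F"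
    by (simp only: pushforward_apply[OF assms] lie_bracket_def)
qed

section \<open>The Levi-Civita connection on left-invariant vector fields\<close>

lemma bij_left_translation:
  assumes "Groups.group m e i"
  shows "bij (m a)" and "inv (m a) = m (i a)"
proof -
  interpret group m e i by fact
  have "m (i a) (m a x) = x" "m a (m (i a) x) = x" for x
    by (simp_all add: assoc[symmetric])
  then show "bij (m a)" "inv (m a) = m (i a)"
    by (auto intro!: bijI' inv_equality) metis+
qed

lemma pushforward_left_translation:
  assumes "lie_group A m e i" and "X \<in> vector_fields A"
  shows "pushforward (m a) X \<in> vector_fields A"
  using assms bij_left_translation[of m e i] smooth_map_left_translation[OF assms(1)]
  by (intro pushforward_vector_field) (auto simp: lie_group_def)

text \<open>Translating back by \<open>i a\<close> gives the preimage. Thus an arbitrary test field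
  can be treated as a translated one.\<close>

lemma pushforward_left_translation_surj:
  assumes G: "lie_group A m e i" and "Z \<in> vector_fields A"
  obtains W where "W \<in> vector_fields A" and "pushforward (m a) W = Z"
proof -
  have grp: "Groups.group m e i"
    using G by (simp add: lie_group_def)
  note bij = bij_left_translation[OF grp]
  show thesis
  proof (rule that)
    show "pushforward (m (i a)) Z \<in> vector_fields A"
      by (rule pushforward_left_translation[OF G assms(2)])
    show "pushforward (m a) (pushforward (m (i a)) Z) = Z"
    proof (rule pushforward_eqI[OF bij(1)])
      fix f
      have "inv (m (i a)) = m a"
        using bij[of a] inv_inv_eq by metis
      then show "pushforward (m (i a)) Z (f \<circ> m a) = Z f \<circ> m a"
        using bij_comp_inv(1)[OF bij(1), of f a] bij(2)[of a] by (simp add: pushforward_def)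
    qed
  qed
qed

section \<open>The Koszul formula and invariance of the connection\<close>

lemma metric_diff_left:
  assumes A: "smooth_atlas A" and g: "pseudo_riemannian_metric A g"
    and "X \<in> vector_fields A" "Y \<in> vector_fields A" "Z \<in> vector_fields A"
  shows "g (X - Y) Z = g X Z - g Y Z"
proof -
  have "g (X - Y + Y) Z = g (X - Y) Z + g Y Z"
    using g vector_field_diff[OF A assms(3,4)] assms(4,5)
    unfolding pseudo_riemannian_metric_def by blast
  then show ?thesis by (simp add: algebra_simps)
qed

lemma metric_sym:
  assumes "pseudo_riemannian_metric A g" and "X \<in> vector_fields A" and "Y \<in> vector_fields A"
  shows "g X Y = g Y X"
  using assms unfolding pseudo_riemannian_metric_def by blast

text \<open>Torsion-freeness and metric compatibility turn every term on the right into terms of the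
  shape \<open>g (nabla U W) V\<close>, and all but two copies of \<open>g (nabla X Y) Z\<close>
  cancel.\<close>

lemma koszul_formula:
  assumes A: "smooth_atlas A" and g: "pseudo_riemannian_metric A g"
    and lc: "levi_civita_connection A g nabla"
    and XYZ: "X \<in> vector_fields A" "Y \<in> vector_fields A" "Z \<in> vector_fields A"
  shows "g (nabla X Y) Z + g (nabla X Y) Z = X (g Y Z) + Y (g Z X) - Z (g X Y)
    + g (lie_bracket X Y) Z - g (lie_bracket X Z) Y - g (lie_bracket Y Z) X"
proof -
  have nabla: "nabla U W \<in> vector_fields A"
    if "U \<in> vector_fields A" "W \<in> vector_fields A" for U W
    using lc that unfolding levi_civita_connection_def affine_connection_def by blast
  have torsion: "g (lie_bracket U W) V = g (nabla U W) V - g (nabla W U) V"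
    if "U \<in> vector_fields A" "W \<in> vector_fields A" "V \<in> vector_fields A" for U W V
  proof -
    have "lie_bracket U W = nabla U W - nabla W U"
      using lc that unfolding levi_civita_connection_def by metis
    then show ?thesis
      using metric_diff_left[OF A g] nabla that by simp
  qed
  have compat: "U (g W V) = g (nabla U W) V + g (nabla U V) W"
    if "U \<in> vector_fields A" "W \<in> vector_fields A" "V \<in> vector_fields A" for U W V
  proof -
    have "U (g W V) = g (nabla U W) V + g W (nabla U V)"
      using lc that unfolding levi_civita_connection_def by blast
    then show ?thesis
      using metric_sym[OF g that(2) nabla[OF that(1,3)]] by simp
  qed
  show ?thesis
    by (simp add: torsion compat XYZ fun_eq_iff)
qed

lemma lie_algebraD:
  assumes "X \<in> lie_algebra A m"
  shows "X \<in> vector_fields A" and "pushforward (m a) X = X"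
  using assms by (auto simp: lie_algebra_def)

text \<open>Torsion-freeness writes the bracket as a difference of two vector fields, which replaces
  a direct check of the Leibniz rule for commutators.\<close>

lemma levi_civita_bracket_vector_field:
  assumes A: "smooth_atlas A" and lc: "levi_civita_connection A g nabla"
    and XY: "X \<in> vector_fields A" "Y \<in> vector_fields A"
  shows "lie_bracket X Y \<in> vector_fields A"
proof -
  have "lie_bracket X Y = nabla X Y - nabla Y X"
    using lc XY unfolding levi_civita_connection_def by metis
  moreover have "nabla X Y \<in> vector_fields A" "nabla Y X \<in> vector_fields A"
    using lc XY unfolding levi_civita_connection_def affine_connection_def by blast+
  ultimately show ?thesis
    using vector_field_diff[OF A] by simp
qed

lemma lie_bracket_left_invariant:
  assumes G: "lie_group A m e i" and lc: "levi_civita_connection A g nabla"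
    and X: "X \<in> lie_algebra A m" and Y: "Y \<in> lie_algebra A m"
  shows "lie_bracket X Y \<in> lie_algebra A m"
proof -
  have A: "smooth_atlas A" and grp: "Groups.group m e i"
    using G by (auto simp: lie_group_def)
  have "lie_bracket X Y \<in> vector_fields A"
    by (rule levi_civita_bracket_vector_field[OF A lc lie_algebraD(1)[OF X] lie_algebraD(1)[OF Y]])
  then show ?thesis
    using pushforward_bracket[OF bij_left_translation(1)[OF grp]] lie_algebraD(2)[OF X]
      lie_algebraD(2)[OF Y] by (simp add: lie_algebra_def)
qed

text \<open>The right-hand side of the Koszul formula is natural under left translations, and
  non-degeneracy of \<open>g\<close> turns this into invariance of \<open>nabla X Y\<close>. Testing against arbitrary
  vector fields avoids the fact that left-invariant fields span the tangent spaces.\<close>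

lemma levi_civita_left_invariant:
  assumes G: "lie_group A m e i" and g: "pseudo_riemannian_metric A g"
    and inv: "left_invariant_metric A m g" and lc: "levi_civita_connection A g nabla"
    and X: "X \<in> lie_algebra A m" and Y: "Y \<in> lie_algebra A m"
  shows "nabla X Y \<in> lie_algebra A m"
proof -
  have A: "smooth_atlas A" and grp: "Groups.group m e i"
    using G by (auto simp: lie_group_def)
  note XY = lie_algebraD(1)[OF X] lie_algebraD(1)[OF Y]
  have N: "nabla X Y \<in> vector_fields A"
    using lc XY unfolding levi_civita_connection_def affine_connection_def by blast
  note vf_bracket = levi_civita_bracket_vector_field[OF A lc]
  have "pushforward (m a) (nabla X Y) = nabla X Y" for a
  proof -
    let ?P = "pushforward (m a)"
    note bij = bij_left_translation(1)[OF grp, of a]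
    note PX = lie_algebraD(2)[OF X, of a] and PY = lie_algebraD(2)[OF Y, of a]
    have PN: "?P (nabla X Y) \<in> vector_fields A"
      by (rule pushforward_left_translation[OF G N])
    have invg: "g (?P U) (?P W) \<circ> m a = g U W"
      if "U \<in> vector_fields A" "W \<in> vector_fields A" for U W
      using inv that unfolding left_invariant_metric_def by blast
    have eq: "g (?P (nabla X Y)) Z = g (nabla X Y) Z" if Z: "Z \<in> vector_fields A" for Z
    proof -
      \<comment> \<open>The Koszul expression tested against \<open>Z\<close> and composed with
        \<open>m a\<close> becomes the one tested against \<open>W\<close>, because \<open>X\<close>
        and \<open>Y\<close> are fixed by \<open>?P\<close>.\<close>
      obtain W where W: "W \<in> vector_fields A" "?P W = Z"
        using pushforward_left_translation_surj[OF G Z] .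
      have natural: "U' f' \<circ> m a = U f"
        if "?P U = U'" "f' \<circ> m a = f" for U U' f f'
        using pushforward_apply[OF bij, of U f'] that by simp
      have gs: "g Y Z \<circ> m a = g Y W" "g Z X \<circ> m a = g W X" "g X Y \<circ> m a = g X Y"
        using invg[OF XY(2) W(1)] invg[OF W(1) XY(1)] invg[OF XY] PX PY W(2) by simp_all
      have br: "?P (lie_bracket X Y) = lie_bracket X Y" "?P (lie_bracket X W) = lie_bracket X Z"
        "?P (lie_bracket Y W) = lie_bracket Y Z"
        using pushforward_bracket[OF bij] PX PY W by simp_all
      have "(X (g Y Z) + Y (g Z X) - Z (g X Y)
          + g (lie_bracket X Y) Z - g (lie_bracket X Z) Y - g (lie_bracket Y Z) X) \<circ> m a
        = (X (g Y Z) \<circ> m a) + (Y (g Z X) \<circ> m a) - (Z (g X Y) \<circ> m a)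
          + (g (lie_bracket X Y) Z \<circ> m a) - (g (lie_bracket X Z) Y \<circ> m a)
          - (g (lie_bracket Y Z) X \<circ> m a)"
        by (simp add: fun_eq_iff)
      moreover have "X (g Y Z) \<circ> m a = X (g Y W)" "Y (g Z X) \<circ> m a = Y (g W X)"
        "Z (g X Y) \<circ> m a = W (g X Y)"
        by (rule natural[OF PX gs(1)] natural[OF PY gs(2)] natural[OF W(2) gs(3)])+
      moreover have "g (lie_bracket X Y) Z \<circ> m a = g (lie_bracket X Y) W"
        "g (lie_bracket X Z) Y \<circ> m a = g (lie_bracket X W) Y"
        "g (lie_bracket Y Z) X \<circ> m a = g (lie_bracket Y W) X"
        using invg[OF vf_bracket[OF XY] W(1)] invg[OF vf_bracket[OF XY(1) W(1)] XY(2)]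
          invg[OF vf_bracket[OF XY(2) W(1)] XY(1)] br PX PY W(2) by simp_all
      ultimately have "(g (nabla X Y) Z + g (nabla X Y) Z) \<circ> m a
          = g (nabla X Y) W + g (nabla X Y) W"
        by (simp only: koszul_formula[OF A g lc XY Z] koszul_formula[OF A g lc XY W(1)])
      then have "g (nabla X Y) Z \<circ> m a = g (nabla X Y) W"
        by (simp add: fun_eq_iff)
      also have "\<dots> = g (?P (nabla X Y)) Z \<circ> m a"
        using invg[OF N W(1)] W(2) by simp
      finally have "g (?P (nabla X Y)) Z \<circ> m a \<circ> inv (m a) = g (nabla X Y) Z \<circ> m a \<circ> inv (m a)"
        by simp
      then show ?thesis
        by (simp only: bij_comp_inv[OF bij])
    qed
    define D where "D = ?P (nabla X Y) - nabla X Y"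
    have D: "D \<in> vector_fields A"
      unfolding D_def by (rule vector_field_diff[OF A PN N])
    have "g D Z p = 0" if "Z \<in> vector_fields A" for Z p
      using metric_diff_left[OF A g PN N that] eq[OF that] by (simp add: D_def)
    then have "D f p = 0" if "f \<in> smooth_functions A" for f p
      using g D that unfolding pseudo_riemannian_metric_def by blast
    \<comment> \<open>\<open>D = 0\<close> is an equality at all arguments, so the normalisation off
      the smooth functions enters as well.\<close>
    moreover have "D f p = 0" if "f \<notin> smooth_functions A" for f p
      using D that by (simp add: vector_fields_def)
    ultimately have "D = 0"
      by (auto simp: fun_eq_iff)
    then show ?thesis
      by (simp add: D_def)
  qed
  with N show ?thesis
    by (simp add: lie_algebra_def)
qed

section \<open>The scalar product on the Lie algebra and the trace computation\<close>

lemma metric_left_invariant_const: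
  assumes grp: "Groups.group m e i" and inv: "left_invariant_metric A m g"
    and X: "X \<in> lie_algebra A m" and Y: "Y \<in> lie_algebra A m"
  shows "g X Y = (\<lambda>_. g X Y e)"
proof
  fix p
  interpret group m e i by fact
  \<comment> \<open>Translation by \<open>p\<close> carries \<open>e\<close> to \<open>p\<close>, so
    this identity is to be evaluated at \<open>e\<close>.\<close>
  have "g X Y \<circ> m p = g X Y"
    using inv lie_algebraD[OF X] lie_algebraD[OF Y] unfolding left_invariant_metric_def by metis
  then show "g X Y p = g X Y e"
    by (metis comp_apply right_neutral)
qed

text \<open>Real scalars act as multiplication by constant functions, so linearity over smooth
  functions yields real linearity in the first slot; symmetry transfers it to the second.\<close>

lemma metric_bilinear_form_on:
  assumes A: "smooth_atlas A" and g: "pseudo_riemannian_metric A g"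
    and "subspace V" and V: "V \<subseteq> vector_fields A"
  shows "bilinear_form_on V (\<lambda>X Y. g X Y p)"
proof -
  have "g (X + Y) Z = g X Z + g Y Z" if "X \<in> V" "Y \<in> V" "Z \<in> V" for X Y Z
    using g that V unfolding pseudo_riemannian_metric_def by blast
  moreover have "g (c *\<^sub>R X) Z p = c * g X Z p" if "X \<in> V" "Z \<in> V" for X Z c
  proof -
    have "g (mult_field (\<lambda>_. c) X) Z = (\<lambda>_. c) * g X Z"
      using g that V smooth_functions_const[OF A, of c]
      unfolding pseudo_riemannian_metric_def by blast
    moreover have "mult_field (\<lambda>_. c) X = c *\<^sub>R X"
      by (simp add: mult_field_def scaleR_fun_def fun_eq_iff)
    ultimately show ?thesis by simp
  qed
  ultimately have left: "linear_on V (\<lambda>X. g X Z p)" if "Z \<in> V" for Z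
    using that by (simp add: linear_on_def)
  have "g X Y = g Y X" if "X \<in> V" "Y \<in> V" for X Y
    using metric_sym[OF g] that V by blast
  then have "linear_on V (\<lambda>Y. g X Y p)" if "X \<in> V" for X
    using left[OF that] that \<open>subspace V\<close>
    by (simp add: linear_on_def subspace_add subspace_scale)
  with left show ?thesis
    by (simp add: bilinear_form_on_def)
qed

lemma riemannian_divergence_eq:
  assumes G: "lie_group A m e i" and metric: "associated_metric A m e \<G> g"
    and lc: "levi_civita_connection A g nabla" and X: "X \<in> lie_algebra A m"
  shows "trace_on (lie_algebra A m) (\<lambda>Y. nabla Y X) = - trace_form A m X"
proof (cases "\<exists>B. finite B \<and> independent B \<and> span B = lie_algebra A m")
  case False
  then show ?thesis
    unfolding trace_form_def trace_on_def by (simp only: if_False minus_zero)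
next
  case True
  have A: "smooth_atlas A" and grp: "Groups.group m e i"
    using G by (auto simp: lie_group_def)
  have g: "pseudo_riemannian_metric A g" and inv: "left_invariant_metric A m g"
    using metric by (auto simp: associated_metric_def)
  obtain h where h: "inverse_form_on (lie_algebra A m) (\<lambda>X Y. g X Y e) h"
    using metric by (auto simp: associated_metric_def)
  define V where "V = lie_algebra A m"
  \<comment> \<open>This is the very basis chosen inside \<open>trace_on\<close>, so all traces
    below are sums over the same \<open>B\<close> and basis independence is not an issue.\<close>
  define B where "B = (SOME B. finite B \<and> independent B \<and> span B = V)"
  have B: "finite B" "independent B" "span B = V"
    using someI_ex[OF True] by (simp_all add: B_def V_def)
  have trace: "trace_on V T = (\<Sum>b\<in>B. representation B (T b) b)" for T
    using True unfolding trace_on_def B_def V_def Let_def by (simp only: if_True)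
  have BV: "b \<in> V" if "b \<in> B" for b
    using B(3) that span_base by blast
  have V: "V \<subseteq> vector_fields A"
    using lie_algebraD(1) by (auto simp: V_def)
  have nablaV: "nabla Y Z \<in> V" if "Y \<in> V" "Z \<in> V" for Y Z
    using levi_civita_left_invariant[OF G g inv lc] that by (simp add: V_def)
  have "g (nabla X Y) Z e = - g Y (nabla X Z) e" if "Y \<in> V" "Z \<in> V" for Y Z
  proof -
    have "g Y Z = (\<lambda>_. g Y Z e)"
      using metric_left_invariant_const[OF grp inv] that by (simp add: V_def)
    then have "X (g Y Z) = 0"
      using vector_field_const[OF A lie_algebraD(1)[OF X]] by metis
    moreover have "X (g Y Z) = g (nabla X Y) Z + g Y (nabla X Z)"
      using lc lie_algebraD(1)[OF X] that V unfolding levi_civita_connection_def by blast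
    ultimately have "(g (nabla X Y) Z + g Y (nabla X Z)) e = 0"
      by simp
    then show ?thesis by simp
  qed
  moreover have "symmetric_on V (\<lambda>X Y. g X Y e)"
    using metric_sym[OF g] V by (auto simp: symmetric_on_def subset_iff)
  moreover have "bilinear_form_on V (\<lambda>X Y. g X Y e)"
    using metric_bilinear_form_on[OF A g _ V] B(3) subspace_span by blast
  \<comment> \<open>The pointwise condition in \<open>pseudo_riemannian_metric\<close> tests against
    all vector fields; non-degeneracy among left-invariant ones is read off from the inverse form
    \<open>h\<close>.\<close>
  moreover have "nondegenerate_on V (\<lambda>X Y. g X Y e)"
    using nondegenerate_on_of_inverse_form[OF B] h by (simp add: V_def)
  ultimately have skew: "(\<Sum>b\<in>B. representation B (nabla X b) b) = 0"
    using nablaV X by (intro trace_skew_eq_0[OF B, where b = "\<lambda>X Y. g X Y e"]) (auto simp: V_def)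
  have "representation B (nabla b X) b
      = representation B (nabla X b) b - representation B (lie_bracket X b) b" if "b \<in> B" for b
  proof -
    have bV: "b \<in> lie_algebra A m"
      using BV[OF that] by (simp add: V_def)
    have "nabla X b - nabla b X = lie_bracket X b"
      using lc lie_algebraD(1)[OF X] lie_algebraD(1)[OF bV]
      unfolding levi_civita_connection_def by blast
    then have "nabla b X = nabla X b - lie_bracket X b"
      by (metis diff_diff_eq2 add_diff_cancel_left')
    \<comment> \<open>\<open>representation B\<close> respects differences only inside
      \<open>span B\<close>; this is where invariance of the connection and the bracket
      enters.\<close>
    moreover have "nabla X b \<in> span B" "lie_bracket X b \<in> span B"
      using B(3) nablaV X bV lie_bracket_left_invariant[OF G lc X bV] by (auto simp: V_def)
    ultimately show ?thesis
      using representation_diff[OF B(2)] by simp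
  qed
  then have "trace_on V (\<lambda>Y. nabla Y X) = - trace_on V (\<lambda>Y. lie_bracket X Y)"
    using skew by (simp add: trace sum_subtractf)
  then show ?thesis
    by (simp add: V_def trace_form_def)
qed

theorem proposition2p17:
  fixes A :: "('a::{t2_space,second_countable_topology}, 'e::real_inner) atlas"
    and m :: "'a \<Rightarrow> 'a \<Rightarrow> 'a" and e :: 'a and i :: "'a \<Rightarrow> 'a"
    and H :: "'a vector_field \<Rightarrow> 'a vector_field \<Rightarrow> 'a vector_field \<Rightarrow> 'a \<Rightarrow> real"
    and \<G> :: "'a generalized_section \<Rightarrow> 'a generalized_section \<Rightarrow> real"
    and g :: "'a vector_field \<Rightarrow> 'a vector_field \<Rightarrow> 'a \<Rightarrow> real"
    and nabla :: "'a vector_field \<Rightarrow> 'a vector_field \<Rightarrow> 'a vector_field"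
  assumes "generalized_pseudo_riemannian_lie_group A m e i H \<G>"
    and "associated_metric A m e \<G> g"
    and "levi_civita_connection A g nabla"
  shows "(\<forall>v\<in>generalized_algebra A m. riemannian_divergence A m nabla v = - trace_form A m (fst v)) \<and>
         (unimodular A m \<longrightarrow> (\<forall>v\<in>generalized_algebra A m. riemannian_divergence A m nabla v = 0))"
proof -
  have G: "lie_group A m e i"
    using assms(1) by (simp add: generalized_pseudo_riemannian_lie_group_def)
  have "riemannian_divergence A m nabla v = - trace_form A m (fst v)" and "fst v \<in> lie_algebra A m"
    if "v \<in> generalized_algebra A m" for v
    using riemannian_divergence_eq[OF G assms(2,3), of "fst v"] that
    by (auto simp: riemannian_divergence_def generalized_algebra_def)
  then show ?thesis
    by (simp add: unimodular_def)
qed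

end
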